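(* Let $G=(\mathcal{V},\mathcal{E}_{G})$ and $H=(\mathcal{V},\mathcal{E}_{H})$ be connected (weighted) graphs over the same set of $n$ vertices, and let $L_{G}$, $L_{H}$ be their respective Laplacians. Assume $L_{H}\preceq L_{G}$. Then $$\mathrm{ld}(L_{H})+\log\left(\mathrm{st}_{H}(G)-n+2\right)\leq\mathrm{ld}(L_{G})\leq\mathrm{ld}(L_{H})+(n-1)\log\left(\frac{\mathrm{st}_{H}(G)}{n-1}\right).$$ This bound is tight, in the sense that there are such $G,H$ for which the inequalities are equalities.
   Context: Graphs have positive edge weights $\omega_{(u,v)}$, and the Laplacian of $G$ is $L_G=\sum_{(u,v)\in\mathcal{E}_G}\omega_{(u,v)}(\mathcal{X}_u-\mathcal{X}_v)(\mathcal{X}_u-\mathcal{X}_v)^T$, where $\mathcal{X}_u\in\mathbb{R}^n$ is the unit vector that is $1$ at position $u$ and zero otherwise. $\preceq$ is the Loewner order and $M^+$ is the Moore–Penrose pseudo-inverse. The pseudo-log-determinant of a non-null positive semi-definite matrix $M$ with eigenvalues $\lambda_i$ is $\mathrm{ld}(M)=\sum_{\lambda_i>0}\log\lambda_i$. The generalized stretch of $G$ with respect to $H$ is $$\mathrm{st}_{H}(G)=\sum_{(u,v)\in\mathcal{E}_{G}}\omega_{(u,v)}(\mathcal{X}_{u}-\mathcal{X}_{v})^{T}L_{H}^{+}(\mathcal{X}_{u}-\mathcal{X}_{v}),$$ where $\omega_{(u,v)}$ is the weight of the edge $(u,v)$ in $G$. *)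

theory Defs
  imports
    "HOL-Analysis.Analysis"
    "HOL-Computational_Algebra.Polynomial"
begin

text \<open>
  Simple undirected graphs with weighted edges; the vertex set is the whole (finite) type.
  An undirected edge is stored once, as a pair \<open>(u, v)\<close> in an arbitrary orientation
  (hence \<open>asym\<close>, which also excludes loops). The Laplacian, the stretch and connectedness
  below do not depend on the orientation. Weights outside the edge set are irrelevant.
\<close>

record 'v wgraph =
  edges :: "('v \<times> 'v) set"
  weight :: "'v \<times> 'v \<Rightarrow> real"

definition weighted_graph :: "'v wgraph \<Rightarrow> bool" where
  "weighted_graph G \<longleftrightarrow> asym (edges G) \<and> (\<forall>e\<in>edges G. weight G e > 0)"

definition connected_graph :: "'v wgraph \<Rightarrow> bool" where
  "connected_graph G \<longleftrightarrow> (\<forall>u v. (u, v) \<in> (edges G \<union> (edges G)\<inverse>)\<^sup>*)"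

definition edge_vec :: "'n \<Rightarrow> 'n \<Rightarrow> real^'n::finite" where
  "edge_vec u v = axis u 1 - axis v 1"

definition laplacian :: "'n wgraph \<Rightarrow> real^'n^'n::finite" where
  "laplacian G =
     (\<Sum>(u, v)\<in>edges G. weight G (u, v) *\<^sub>R
        ((columnvector (edge_vec u v) :: real^1^'n) ** rowvector (edge_vec u v)))"

definition pos_semidef :: "real^'n^'n \<Rightarrow> bool" where
  "pos_semidef A \<longleftrightarrow> transpose A = A \<and> (\<forall>x. 0 \<le> x \<bullet> (A *v x))"

definition loewner_le :: "real^'n^'n \<Rightarrow> real^'n^'n \<Rightarrow> bool"  (infix "\<preceq>\<^sub>L" 50) where
  "A \<preceq>\<^sub>L B \<longleftrightarrow> pos_semidef (B - A)"

definition is_pinv :: "real^'n^'m \<Rightarrow> real^'m^'n \<Rightarrow> bool" where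
  "is_pinv A X \<longleftrightarrow>
     A ** X ** A = A \<and> X ** A ** X = X \<and>
     transpose (A ** X) = A ** X \<and> transpose (X ** A) = X ** A"

definition pinv :: "real^'n^'m \<Rightarrow> real^'m^'n" where
  "pinv A = (THE X. is_pinv A X)"

lemma is_pinv_unique:
  fixes A :: "real^'n^'m"
  assumes X: "is_pinv A X" and Y: "is_pinv A Y"
  shows "X = Y"
proof -
  have "transpose (A ** Y) = transpose (A ** X ** (A ** Y))"
    using X by (simp add: is_pinv_def matrix_mul_assoc)
  also have "\<dots> = A ** Y ** (A ** X)"
    using X Y by (simp add: is_pinv_def matrix_transpose_mul)
  also have "\<dots> = A ** X"
    using Y by (simp add: is_pinv_def matrix_mul_assoc)
  finally have AX: "A ** Y = A ** X"
    using Y by (simp add: is_pinv_def)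
  have "transpose (Y ** A) = transpose (Y ** A ** (X ** A))"
    using X by (metis is_pinv_def matrix_mul_assoc)
  also have "\<dots> = X ** A ** (Y ** A)"
    using X Y by (simp add: is_pinv_def matrix_transpose_mul)
  also have "\<dots> = X ** A"
    using Y by (metis is_pinv_def matrix_mul_assoc)
  finally have XA: "Y ** A = X ** A"
    using Y by (simp add: is_pinv_def)
  have "X = X ** A ** X" using X by (simp add: is_pinv_def)
  also have "\<dots> = Y ** A ** Y" by (metis AX XA matrix_mul_assoc)
  also have "\<dots> = Y" using Y by (simp add: is_pinv_def)
  finally show ?thesis .
qed

lemma pinv_eqI: "is_pinv A X \<Longrightarrow> pinv A = X"
  unfolding pinv_def by (blast intro: is_pinv_unique)

definition charpoly :: "'a::comm_ring_1^'n^'n \<Rightarrow> 'a poly" where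
  "charpoly A = det (mat [:0, 1:] - (\<chi> i j. [:A $ i $ j:]))"

text \<open>The multiset of real eigenvalues, with algebraic multiplicity.\<close>

definition eigenvalues :: "real^'n^'n \<Rightarrow> real multiset" where
  "eigenvalues A = proots (charpoly A)"

definition ld :: "real^'n^'n \<Rightarrow> real" where
  "ld A = (\<Sum>x\<in>#filter_mset (\<lambda>x. x > 0) (eigenvalues A). ln x)"

text \<open>\<open>stretch H G\<close> is the generalized stretch of \<open>G\<close> with respect to \<open>H\<close>.\<close>

definition stretch :: "'n::finite wgraph \<Rightarrow> 'n wgraph \<Rightarrow> real" where
  "stretch H G =
     (\<Sum>(u, v)\<in>edges G. weight G (u, v) *
        (edge_vec u v \<bullet> (pinv (laplacian H) *v edge_vec u v)))"

end

theory Submission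
  imports Defs
begin

text \<open>
  Let \<open>n\<close> be the number of vertices, \<open>J\<close> the orthogonal projection onto the constant vectors
  and \<open>A = L\<^sub>H + J\<close>, \<open>B = L\<^sub>G + J\<close>. Since a connected Laplacian has exactly the constants as kernel,
  \<open>A\<close> and \<open>B\<close> are positive definite, \<open>ld L\<^sub>H = ln (det A)\<close>, \<open>ld L\<^sub>G = ln (det B)\<close>, and the
  pseudo-inverse of \<open>L\<^sub>H\<close> is the inverse of \<open>A\<close> minus \<open>J\<close>. Simultaneous diagonalization turns
  \<open>A\<close> into the identity and \<open>B\<close> into a diagonal matrix with entries \<open>m\<^sub>i \<ge> 1\<close>, one of which is 1
  because \<open>A\<close> and \<open>B\<close> agree on the constants. The other \<open>n - 1\<close> entries sum to the stretch and
  multiply to \<open>det B / det A\<close>, so the upper bound is the AM-GM inequality and the lower bound is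
  \<open>1 + (\<Sum>i. m\<^sub>i - 1) \<le> (\<Prod>i. m\<^sub>i)\<close>. Both are equalities for \<open>G = H\<close>, where all \<open>m\<^sub>i\<close> are 1.
\<close>

section \<open>The spectral theorem for symmetric matrices\<close>

text \<open>A maximizer \<open>v\<close> of the Rayleigh quotient on the unit sphere is an eigenvector: with \<open>c\<close> the
  maximum, \<open>h x = c x - f x\<close> is positive semidefinite and \<open>v \<bullet> h v = 0\<close>; perturbing \<open>v\<close> in the
  direction \<open>h v\<close> forces \<open>h v = 0\<close>.\<close>

lemma selfadjoint_eigenvector_exists:
  fixes f :: "'a::euclidean_space \<Rightarrow> 'a"
  assumes lin: "linear f" and sa: "\<And>x y. f x \<bullet> y = x \<bullet> f y"
    and S: "subspace S" and inv: "\<And>x. x \<in> S \<Longrightarrow> f x \<in> S" and nz: "S \<noteq> {0}"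
  obtains v c where "v \<in> S" "norm v = 1" "f v = c *\<^sub>R v"
proof -
  obtain w where w: "w \<in> S" "w \<noteq> 0"
    using nz S subspace_0 by blast
  have "compact (sphere 0 1 \<inter> S)"
    by (intro compact_Int_closed compact_sphere closed_subspace S)
  moreover have "(1 / norm w) *\<^sub>R w \<in> sphere 0 1 \<inter> S"
    using w S by (auto simp: subspace_scale)
  moreover have "continuous_on (sphere 0 1 \<inter> S) (\<lambda>x. x \<bullet> f x)"
    by (intro continuous_intros linear_continuous_on linear_conv_bounded_linear[THEN iffD1] lin)
  ultimately obtain v where v: "v \<in> sphere 0 1 \<inter> S"
    and vmax: "\<And>x. x \<in> sphere 0 1 \<inter> S \<Longrightarrow> x \<bullet> f x \<le> v \<bullet> f v"
    using continuous_attains_sup[of "sphere 0 1 \<inter> S" "\<lambda>x. x \<bullet> f x"] by blast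
  define c where "c = v \<bullet> f v"
  define h where "h = (\<lambda>x. c *\<^sub>R x - f x)"
  have vv: "v \<in> S" "norm v = 1" "v \<bullet> v = 1"
    using v by (auto simp: norm_eq_1)
  have h_psd: "0 \<le> x \<bullet> h x" if "x \<in> S" for x
  proof (cases "x = 0")
    case False
    let ?u = "(1 / norm x) *\<^sub>R x"
    have "?u \<in> sphere 0 1 \<inter> S"
      using that False S by (auto simp: subspace_scale)
    then have "?u \<bullet> f ?u \<le> c"
      unfolding c_def by (rule vmax)
    moreover have "?u \<bullet> f ?u = (x \<bullet> f x) / (x \<bullet> x)"
      using False by (simp add: linear_scale[OF lin] dot_square_norm power2_eq_square)
    ultimately have "(x \<bullet> f x) / (x \<bullet> x) \<le> c"
      by argo
    moreover have "x \<bullet> x > 0"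
      using False by simp
    ultimately have "x \<bullet> f x \<le> c * (x \<bullet> x)"
      by (simp only: divide_le_eq if_True)
    then show ?thesis
      by (simp add: h_def inner_diff_right)
  qed (simp add: h_def linear_0[OF lin])
  have lin_h: "h (x + t *\<^sub>R y) = h x + t *\<^sub>R h y" for x y t
    by (simp add: h_def linear_add[OF lin] linear_scale[OF lin] algebra_simps)
  have sa_h: "h x \<bullet> y = x \<bullet> h y" for x y
    by (simp add: h_def sa inner_diff_left inner_diff_right)
  have vhv: "v \<bullet> h v = 0"
    using vv by (simp add: h_def c_def inner_diff_right)
  define y where "y = h v"
  have yS: "y \<in> S"
    unfolding y_def h_def using vv S inv by (simp add: subspace_diff subspace_scale)
  have quad: "0 \<le> t * (2 * (y \<bullet> y) + t * (y \<bullet> h y))" for t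
  proof -
    have "0 \<le> (v + t *\<^sub>R y) \<bullet> h (v + t *\<^sub>R y)"
      using vv yS S by (intro h_psd) (simp add: subspace_add subspace_scale)
    also have "\<dots> = t * (2 * (y \<bullet> y) + t * (y \<bullet> h y))"
      using vhv sa_h[of v y]
      by (simp add: lin_h inner_add_left inner_add_right flip: y_def) (simp add: algebra_simps)
    finally show ?thesis .
  qed
  have "y \<bullet> y = 0"
  proof (rule ccontr)
    assume "y \<bullet> y \<noteq> 0"
    then have a: "y \<bullet> y > 0" by simp
    have b: "y \<bullet> h y \<ge> 0" by (rule h_psd[OF yS])
    \<comment> \<open>The step is negative, and the \<open>+ 1\<close> both avoids a zero
      denominator and keeps \<open>t * (y \<bullet> h y)\<close> at least
      \<open>- (y \<bullet> y)\<close>. The second factor of \<open>quad\<close> then stays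
      positive, so the product is negative.\<close>
    define t where "t = - (y \<bullet> y) / (y \<bullet> h y + 1)"
    have t: "t < 0" using a b by (simp add: t_def divide_neg_pos)
    have "2 * (y \<bullet> y) + t * (y \<bullet> h y) \<le> 0"
      using quad[of t] t unfolding zero_le_mult_iff by linarith
    moreover have "t * (y \<bullet> h y) \<ge> - (y \<bullet> y)"
      using a b by (simp add: t_def field_simps)
    ultimately show False using a by linarith
  qed
  then have "f v = c *\<^sub>R v"
    by (simp add: y_def h_def)
  with vv that show thesis by blast
qed

text \<open>Induction on the dimension: split off a unit eigenvector \<open>v\<close>.
  Self-adjointness makes its orthogonal complement in \<open>S\<close> invariant, since
  \<open>v \<bullet> f x = f v \<bullet> x = c * (v \<bullet> x)\<close>.\<close>

lemma selfadjoint_orthonormal_eigenbasis: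
  fixes f :: "'a::euclidean_space \<Rightarrow> 'a"
  assumes lin: "linear f" and sa: "\<And>x y. f x \<bullet> y = x \<bullet> f y"
    and "subspace S" and "\<And>x. x \<in> S \<Longrightarrow> f x \<in> S"
  shows "\<exists>B. pairwise orthogonal B \<and> (\<forall>b\<in>B. norm b = 1 \<and> (\<exists>c. f b = c *\<^sub>R b)) \<and> span B = S"
  using assms(3,4)
proof (induction "dim S" arbitrary: S rule: less_induct)
  case (less S)
  show ?case
  proof (cases "S = {0}")
    case True
    then show ?thesis by (intro exI[of _ "{}"]) auto
  next
    case False
    obtain v c where v: "v \<in> S" "norm v = 1" "f v = c *\<^sub>R v"
      using selfadjoint_eigenvector_exists[OF lin sa less.prems False] by blast
    define T where "T = {x \<in> S. v \<bullet> x = 0}"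
    have T: "subspace T"
      using less.prems(1) by (auto simp: T_def subspace_def inner_add_right)
    have "v \<notin> T" using v by (auto simp: T_def)
    moreover have "T \<subseteq> S" by (auto simp: T_def)
    ultimately have "T \<subset> S" using v(1) by blast
    then have "dim T < dim S"
      using T less.prems(1) by (metis dim_psubset span_eq_iff)
    moreover have "f x \<in> T" if "x \<in> T" for x
      using that less.prems(2) v(3) sa[of v x] by (simp add: T_def)
    ultimately obtain B where B: "pairwise orthogonal B" "span B = T"
      "\<forall>b\<in>B. norm b = 1 \<and> (\<exists>c. f b = c *\<^sub>R b)"
      using less.hyps T by blast
    have "B \<subseteq> T" using B(2) span_superset by blast
    then have "pairwise orthogonal (insert v B)"
      using B(1) by (auto simp: pairwise_insert T_def orthogonal_def inner_commute)
    moreover have "span (insert v B) = S"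
    proof
      show "span (insert v B) \<subseteq> S"
        using v(1) \<open>B \<subseteq> T\<close> \<open>T \<subset> S\<close> less.prems(1) by (intro span_minimal) auto
      show "S \<subseteq> span (insert v B)"
      proof
        fix x assume "x \<in> S"
        then have "x - (v \<bullet> x) *\<^sub>R v \<in> T"
          using v less.prems(1)
          by (simp add: T_def subspace_diff subspace_scale inner_diff_right dot_square_norm)
        then show "x \<in> span (insert v B)"
          using B(2) by (auto simp: span_insert)
      qed
    qed
    ultimately show ?thesis
      using B(3) v by (intro exI[of _ "insert v B"]) auto
  qed
qed

section \<open>Matrix algebra, diagonal matrices and diagonalization\<close>

lemma matrix_diff_ldistrib: "A ** (B - C) = A ** B - A ** C"
  for A :: "'a::ring_1^'n^'m"
  by (simp add: vec_eq_iff matrix_matrix_mult_def right_diff_distrib sum_subtractf)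

lemma matrix_diff_rdistrib: "(A - B) ** C = A ** C - B ** C"
  for A :: "'a::ring_1^'n^'m"
  by (simp add: vec_eq_iff matrix_matrix_mult_def left_diff_distrib sum_subtractf)

lemma matrix_add_rdistrib: "(A + B) ** C = A ** C + B ** C"
  for A :: "'a::semiring_1^'n^'m"
  by (simp add: vec_eq_iff matrix_matrix_mult_def distrib_right sum.distrib)

lemma transpose_diff: "transpose (A - B) = transpose A - transpose B"
  by (simp add: vec_eq_iff transpose_def)

lemma transpose_add: "transpose (A + B) = transpose A + transpose B"
  by (simp add: vec_eq_iff transpose_def)

text \<open>Polymorphic in the entries because both real and polynomial diagonals occur
  below.\<close>

definition diag :: "('n \<Rightarrow> 'a::zero) \<Rightarrow> 'a^'n^'n" where
  "diag d = (\<chi> i j. if i = j then d i else 0)"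

lemma mult_diag_nth: "(Q ** diag d) $ i $ j = Q $ i $ j * d j"
  for Q :: "'a::semiring_1^'n^'m"
  by (simp add: matrix_matrix_mult_def diag_def if_distrib[of "\<lambda>x. _ * x"] cong: if_cong)

lemma det_diag: "det (diag d) = prod d UNIV"
  for d :: "'n::finite \<Rightarrow> 'a::comm_ring_1"
  by (subst det_diagonal) (auto simp: diag_def)

lemma trace_diag: "trace (diag d) = sum d UNIV"
  by (simp add: trace_def diag_def)

lemma diag_mult_vec_nth: "(diag d *v x) $ i = d i * x $ i"
  for d :: "'n::finite \<Rightarrow> 'a::semiring_1"
  by (simp add: matrix_vector_mult_def diag_def if_distrib[of "\<lambda>y. y * _"] cong: if_cong)

lemma diag_mult_diag: "diag d ** diag e = diag (\<lambda>i. d i * e i)"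
  for d :: "'n::finite \<Rightarrow> 'a::semiring_1"
  by (simp add: vec_eq_iff mult_diag_nth) (simp add: diag_def)

lemma transpose_diag [simp]: "transpose (diag d) = diag d"
  by (auto simp: vec_eq_iff transpose_def diag_def)

lemma diag_1: "diag (\<lambda>_. 1) = mat 1"
  by (simp add: diag_def mat_def)

text \<open>Passes between eigenvectors and one matrix identity that needs no inverse of
  \<open>Q\<close>. All diagonalizations below have this form.\<close>

lemma mult_eq_mult_diag_iff:
  "A ** Q = Q ** diag d \<longleftrightarrow> (\<forall>i. A *v column i Q = d i *s column i Q)"
  for A Q :: "'a::comm_semiring_1^'n^'n"
proof -
  have "(A ** Q) $ k $ i = (A *v column i Q) $ k" for i k
    by (simp add: matrix_matrix_mult_def matrix_vector_mult_def column_def)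
  then show ?thesis
    by (auto simp: vec_eq_iff mult_diag_nth column_def mult.commute)
qed

text \<open>An orthonormal eigenbasis of the whole space has as many vectors as the index type has
  elements, so they can serve as the columns of \<open>Q\<close>.\<close>

theorem symmetric_matrix_diagonalization:
  fixes A :: "real^'n^'n"
  assumes "transpose A = A"
  obtains Q d where "orthogonal_matrix Q" "A ** Q = Q ** diag d"
proof -
  have "(A *v x) \<bullet> y = x \<bullet> (A *v y)" for x y
    using assms by (metis dot_lmul_matrix vector_transpose_matrix)
  then obtain B where B: "pairwise orthogonal B" "span B = (UNIV :: (real^'n) set)"
    "\<forall>b\<in>B. norm b = 1 \<and> (\<exists>c. A *v b = c *\<^sub>R b)"
    using selfadjoint_orthonormal_eigenbasis[of "(*v) A" UNIV] by auto
  have "independent B"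
    using B by (intro pairwise_orthogonal_independent) auto
  then have "card B = CARD('n)" "finite B"
    using B(2) by (metis basis_card_eq_dim dim_UNIV DIM_cart DIM_real mult.right_neutral subset_UNIV top_greatest) 
      (simp add: \<open>independent B\<close> finiteI_independent)
  then obtain q :: "'n \<Rightarrow> real^'n" where q: "bij_betw q UNIV B"
    by (metis finite_class.finite_UNIV finite_same_card_bij)
  then have qB: "q i \<in> B" for i
    by (auto simp: bij_betw_def)
  then have "\<forall>i. \<exists>c. A *v q i = c *\<^sub>R q i" using B(3) by blast
  then obtain d where d: "\<And>i. A *v q i = d i *\<^sub>R q i" by metis
  define Q :: "real^'n^'n" where "Q = (\<chi> i j. q j $ i)"
  have col: "column i Q = q i" for i
    by (simp add: Q_def column_def vec_eq_iff)
  show thesis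
  proof
    show "orthogonal_matrix Q"
      unfolding orthogonal_matrix_orthonormal_columns col
      using B(1,3) qB q by (auto simp: pairwise_def bij_betw_def inj_eq)
    show "A ** Q = Q ** diag d"
      by (simp add: mult_eq_mult_diag_iff col d scalar_mult_eq_scaleR)
  qed
qed

section \<open>Determinant, characteristic polynomial and log-determinant from a
  diagonalization\<close>

lemma det_diagonalized:
  fixes A :: "real^'n^'n"
  assumes "orthogonal_matrix Q" "A ** Q = Q ** diag d"
  shows "det A = prod d UNIV"
proof -
  have "det A * det Q = det Q * prod d UNIV"
    using arg_cong[OF assms(2), of det] by (simp add: det_mul det_diag)
  moreover have "det Q \<noteq> 0" using det_orthogonal_matrix[OF assms(1)] by auto
  ultimately show ?thesis by simp
qed

text \<open>Over the polynomial ring, \<open>A ** Q = Q ** diag d\<close> becomes (x I - A) Q = Q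
  diag(x - d_i). Taking determinants and cancelling the nonzero constant \<open>det Q\<close> leaves
  the product.\<close>

lemma charpoly_diagonalized:
  fixes A Q :: "'a::idom^'n^'n"
  assumes "det Q \<noteq> 0" "A ** Q = Q ** diag d"
  shows "charpoly A = (\<Prod>i\<in>UNIV. [:- d i, 1:])"
proof -
  \<comment> \<open>\<open>C\<close> lifts a matrix to constant polynomials.\<close>
  define C :: "'a^'n^'n \<Rightarrow> 'a poly^'n^'n" where "C = (\<lambda>M. \<chi> i j. [:M $ i $ j:])"
  have const_sum: "[:sum f S:] = (\<Sum>k\<in>S. [:f k:])" for f :: "'n \<Rightarrow> 'a" and S
    by (rule poly_eqI) (simp add: coeff_sum coeff_pCons split: nat.split)
  have "((mat [:0, 1:] - C A) ** C Q) $ i $ j = (C Q ** diag (\<lambda>i. [:- d i, 1:])) $ i $ j" for i j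
  proof -
    have "(\<Sum>k\<in>UNIV. A $ i $ k * Q $ k $ j) = Q $ i $ j * d j"
      using arg_cong[OF assms(2), of "\<lambda>M. M $ i $ j"]
      by (simp add: mult_diag_nth) (simp add: matrix_matrix_mult_def)
    then have "(\<Sum>k\<in>UNIV. [:A $ i $ k:] * [:Q $ k $ j:]) = [:Q $ i $ j * d j:]"
      by (simp flip: const_sum add: mult.commute)
    moreover have "((mat [:0, 1:] - C A) ** C Q) $ i $ j =
        (\<Sum>k\<in>UNIV. (if i = k then [:0, 1:] * [:Q $ k $ j:] else 0) -
          [:A $ i $ k:] * [:Q $ k $ j:])"
      unfolding matrix_matrix_mult_def C_def mat_def
      by (simp only: vec_lambda_beta vector_minus_component left_diff_distrib)
        (intro sum.cong; simp)
    ultimately show ?thesis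
      by (simp add: sum_subtractf mult_diag_nth C_def mult.commute del: mult_pCons_left mult_pCons_right) simp
  qed
  then have "(mat [:0, 1:] - C A) ** C Q = C Q ** diag (\<lambda>i. [:- d i, 1:])"
    by (simp add: vec_eq_iff)
  then have "charpoly A * det (C Q) = det (C Q) * (\<Prod>i\<in>UNIV. [:- d i, 1:])"
    unfolding charpoly_def C_def[symmetric]
    by (metis det_mul det_diag C_def)
  moreover have "det (C Q) = [:det Q:]"
  proof -
    have const_prod: "(\<Prod>k\<in>S. [:f k:]) = [:prod f S:]" for f :: "'n \<Rightarrow> 'a" and S
      by (induction S rule: infinite_finite_induct) (auto simp: one_pCons)
    have "[:sum f S:] = (\<Sum>k\<in>S. [:f k:])" for f :: "('n \<Rightarrow> 'n) \<Rightarrow> 'a" and S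
      by (rule poly_eqI) (simp add: coeff_sum coeff_pCons split: nat.split)
    then show ?thesis
      by (simp add: det_def C_def of_int_poly mult.commute const_prod)
  qed
  moreover have "[:det Q:] \<noteq> 0" using assms(1) by simp
  ultimately show ?thesis by (metis mult.commute mult_cancel_right)
qed

lemma image_mset_mset_set_eq_sum:
  "finite S \<Longrightarrow> image_mset f (mset_set S) = (\<Sum>i\<in>S. {#f i#})"
  by (induction S rule: finite_induct) auto

lemma ld_diagonalized:
  fixes A :: "real^'n^'n"
  assumes "orthogonal_matrix Q" "A ** Q = Q ** diag d"
  shows "ld A = (\<Sum>i | d i > 0. ln (d i))"
proof -
  have "det Q \<noteq> 0" using det_orthogonal_matrix[OF assms(1)] by auto
  then have "eigenvalues A = (\<Sum>i\<in>UNIV. {#d i#})"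
    unfolding eigenvalues_def
    by (subst charpoly_diagonalized[OF _ assms(2)]) (simp_all add: proots_prod)
  also have "\<dots> = image_mset d (mset_set UNIV)"
    by (rule image_mset_mset_set_eq_sum[symmetric]) simp
  finally show ?thesis
    by (simp add: ld_def filter_mset_image_mset sum_unfold_sum_mset image_mset.compositionality
        comp_def)
qed

text \<open>\<open>R\<close>, the matrix \<open>Q\<close> with columns scaled by 1/sqrt(a_i),
  carries \<open>A\<close> to the identity. An orthogonal \<open>U\<close> then diagonalizes the
  symmetric matrix \<open>transpose R ** B ** R\<close> and preserves the identity, so
  \<open>P = R ** U\<close> works.\<close>

lemma simultaneous_diagonalization:
  fixes A B :: "real^'n^'n"
  assumes Q: "orthogonal_matrix Q" "A ** Q = Q ** diag a" and a: "\<And>i. a i > 0"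
    and B: "transpose B = B"
  obtains P :: "real^'n^'n" and m where "transpose P ** A ** P = mat 1" "transpose P ** B ** P = diag m"
proof -
  define D :: "real^'n^'n" where "D = diag (\<lambda>i. 1 / sqrt (a i))"
  define R where "R = Q ** D"
  have "transpose R ** A ** R = D ** transpose Q ** (A ** Q) ** D"
    by (simp add: R_def matrix_transpose_mul D_def matrix_mul_assoc)
  also have "\<dots> = D ** (transpose Q ** Q) ** diag a ** D"
    by (simp add: Q(2) matrix_mul_assoc)
  also have "\<dots> = mat 1"
    using Q(1) a by (simp add: orthogonal_matrix D_def diag_mult_diag real_div_sqrt less_imp_le
        less_imp_neq[symmetric] flip: diag_1)
  finally have RAR: "transpose R ** A ** R = mat 1" .
  have "transpose (transpose R ** B ** R) = transpose R ** B ** R"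
    by (simp add: matrix_transpose_mul B matrix_mul_assoc)
  then obtain U :: "real^'n^'n" and m where U: "orthogonal_matrix U" "transpose R ** B ** R ** U = U ** diag m"
    using symmetric_matrix_diagonalization by blast
  show thesis
  proof
    have "transpose (R ** U) ** A ** (R ** U) = transpose U ** (transpose R ** A ** R) ** U"
      by (simp add: matrix_transpose_mul matrix_mul_assoc)
    then show "transpose (R ** U) ** A ** (R ** U) = mat 1"
      using U(1) by (simp add: RAR orthogonal_matrix)
    have "transpose (R ** U) ** B ** (R ** U) = transpose U ** (transpose R ** B ** R ** U)"
      by (simp add: matrix_transpose_mul matrix_mul_assoc)
    then show "transpose (R ** U) ** B ** (R ** U) = diag m"
      using U by (simp add: matrix_mul_assoc orthogonal_matrix)
  qed
qed

section \<open>Positive semidefinite matrices whose kernel is the constants\<close>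

text \<open>All that the bounds use about the Laplacian of a connected graph.\<close>

definition psd_const_kernel :: "real^'n^'n \<Rightarrow> bool" where
  "psd_const_kernel A \<longleftrightarrow> pos_semidef A \<and> (\<forall>x. A *v x = 0 \<longleftrightarrow> (\<exists>c. x = vec c))"

definition mean_proj :: "real^'n^'n" where
  "mean_proj = (\<chi> i j. 1 / real CARD('n))"

lemma mean_proj_mult_vec: "mean_proj *v x = vec ((\<Sum>i\<in>UNIV. x $ i) / real CARD('n))"
  for x :: "real^'n"
  by (simp add: mean_proj_def matrix_vector_mult_def vec_eq_iff sum_divide_distrib)

lemma mean_proj_vec [simp]: "mean_proj *v vec c = vec c"
  by (simp add: mean_proj_mult_vec)

lemma transpose_mean_proj [simp]: "transpose mean_proj = mean_proj"
  by (simp add: mean_proj_def transpose_def vec_eq_iff)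

lemma trace_mean_proj: "trace mean_proj = 1"
  by (simp add: trace_def mean_proj_def)

lemma mean_proj_idem: "mean_proj ** mean_proj = mean_proj"
  by (simp add: matrix_matrix_mult_def mean_proj_def)

text \<open>The range of \<open>mean_proj\<close> is the kernel of \<open>A\<close>; the second
  product follows by transposition.\<close>

lemma mult_mean_proj:
  fixes A :: "real^'n^'n"
  assumes "psd_const_kernel A"
  shows "A ** mean_proj = 0" "mean_proj ** A = 0"
proof -
  have "A ** mean_proj *v x = 0" for x
    using assms by (auto simp: psd_const_kernel_def mean_proj_mult_vec simp flip: matrix_vector_mul_assoc)
  then show 0: "A ** mean_proj = 0"
    by (simp add: matrix_eq)
  have "transpose A = A"
    using assms by (simp add: psd_const_kernel_def pos_semidef_def)
  then have "mean_proj ** A = transpose (A ** mean_proj)"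
    by (simp add: matrix_transpose_mul)
  also have "\<dots> = 0"
    by (simp add: 0 transpose_def vec_eq_iff)
  finally show "mean_proj ** A = 0" .
qed

text \<open>Adding the projection onto the constants replaces the single eigenvalue 0 by 1, which
  turns \<^const>\<open>ld\<close> into an honest log-determinant.\<close>

lemma psd_const_kernel_shift:
  fixes A :: "real^'n^'n"
  assumes "psd_const_kernel A"
  obtains Q a where "orthogonal_matrix Q" "(A + mean_proj) ** Q = Q ** diag a" "\<And>i. a i > 0"
    "ld A = ln (det (A + mean_proj))" "det (A + mean_proj) > 0"
proof -
  have sym: "transpose A = A" and psd: "\<And>x. 0 \<le> x \<bullet> (A *v x)"
    and ker: "\<And>x. A *v x = 0 \<longleftrightarrow> (\<exists>c. x = vec c)"
    using assms by (auto simp: psd_const_kernel_def pos_semidef_def)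
  obtain Q d where Q: "orthogonal_matrix Q" "A ** Q = Q ** diag d"
    using symmetric_matrix_diagonalization[OF sym] .
  let ?q = "\<lambda>i. column i Q"
  have Aq: "A *v ?q i = d i *s ?q i" for i
    using Q(2) by (simp add: mult_eq_mult_diag_iff)
  have norm_q: "norm (?q i) = 1" and orth_q: "i \<noteq> j \<Longrightarrow> ?q i \<bullet> ?q j = 0" for i j
    using Q(1) by (auto simp: orthogonal_matrix_orthonormal_columns orthogonal_def)
  have d_nonneg: "d i \<ge> 0" for i
    using psd[of "?q i"] norm_q[of i] by (simp add: Aq scalar_mult_eq_scaleR dot_square_norm)
  \<comment> \<open>Otherwise \<open>A\<close> would be invertible, yet it kills the constant vector
    \<open>vec 1\<close>.\<close>
  have "\<exists>i. d i = 0"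
  proof (rule ccontr)
    assume "\<nexists>i. d i = 0"
    then have "det A \<noteq> 0"
      by (simp add: det_diagonalized[OF Q])
    then obtain B where "B ** A = mat 1"
      by (metis invertible_det_nz invertible_left_inverse)
    moreover have "A *v vec 1 = 0"
      using ker by blast
    ultimately have "(vec 1 :: real^'n) = 0"
      by (metis matrix_vector_mul_assoc matrix_vector_mul_lid matrix_vector_mult_0_right)
    then show False by (simp add: vec_eq_iff)
  qed
  then obtain k where k: "d k = 0" by blast
  then obtain c where c: "?q k = vec c"
    using ker Aq[of k] by auto
  have "c \<noteq> 0"
    using norm_q[of k] unfolding c by auto
  \<comment> \<open>Column \<open>k\<close> is a nonzero constant vector, so orthogonality to it
    means zero entry sum. A second constant column would therefore vanish, so only
    \<open>d k\<close> is zero.\<close>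
  have sum_q: "(\<Sum>j\<in>UNIV. ?q i $ j) = 0" if "i \<noteq> k" for i
    using orth_q[OF that] \<open>c \<noteq> 0\<close> unfolding c by (simp add: inner_vec_def flip: sum_distrib_right)
  have d_pos: "d i > 0" if "i \<noteq> k" for i
  proof -
    have "d i \<noteq> 0"
    proof
      assume "d i = 0"
      then obtain c' where c': "?q i = vec c'"
        using ker Aq[of i] by auto
      with sum_q[OF that] norm_q[of i] show False by simp
    qed
    with d_nonneg[of i] show ?thesis by simp
  qed
  \<comment> \<open>\<open>mean_proj\<close> fixes column \<open>k\<close> and kills the others, so
    only the eigenvalue at \<open>k\<close> changes. The new value 1 contributes nothing to the sum
    of logarithms.\<close>
  define a where "a = d(k := 1)"
  have "(A + mean_proj) *v ?q i = a i *s ?q i" for i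
    using k c Aq[of k] by (cases "i = k")
      (auto simp: a_def matrix_vector_mult_add_rdistrib Aq mean_proj_mult_vec sum_q)
  then have AQ: "(A + mean_proj) ** Q = Q ** diag a"
    by (simp add: mult_eq_mult_diag_iff)
  have a: "a i > 0" for i
    using d_pos by (simp add: a_def)
  have "{i. d i > 0} = UNIV - {k}"
    using d_pos k by fastforce
  then have "ld A = (\<Sum>i\<in>UNIV - {k}. ln (a i))"
    by (simp add: ld_diagonalized[OF Q] a_def)
  also have "\<dots> = (\<Sum>i\<in>UNIV. ln (a i))"
    by (rule sum.mono_neutral_left) (auto simp: a_def)
  also have "\<dots> = ln (det (A + mean_proj))"
    using a by (simp add: det_diagonalized[OF Q(1) AQ] ln_prod less_imp_neq[symmetric])
  finally show thesis
    using that[OF Q(1) AQ a] a by (simp add: det_diagonalized[OF Q(1) AQ] prod_pos)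
qed

text \<open>\<open>A + mean_proj\<close> acts as the identity on the constants, hence so does its
  inverse \<open>M\<close>. This makes the products of \<open>A\<close> with
  \<open>M - mean_proj\<close>, in either order, equal to the symmetric projection
  \<open>mat 1 - mean_proj\<close>, whence the Penrose conditions.\<close>

lemma pinv_psd_const_kernel:
  fixes A :: "real^'n^'n"
  assumes A: "psd_const_kernel A" and M: "M ** (A + mean_proj) = mat 1"
  shows "pinv A = M - mean_proj" "A ** pinv A = mat 1 - mean_proj"
    and "M ** mean_proj = mean_proj" "mean_proj ** M = mean_proj"
proof -
  let ?J = "mean_proj :: real^'n^'n"
  note AJ = mult_mean_proj[OF A] and JJ = mean_proj_idem
  have M': "(A + ?J) ** M = mat 1"
    using M by (simp add: matrix_left_right_inverse)
  show MJ: "M ** ?J = ?J"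
  proof -
    have "(A + ?J) ** ?J = ?J"
      by (simp add: matrix_add_rdistrib AJ JJ)
    then show ?thesis
      using M by (metis matrix_mul_assoc matrix_mul_lid)
  qed
  show JM: "?J ** M = ?J"
  proof -
    have "?J ** (A + ?J) = ?J"
      by (simp add: matrix_add_ldistrib AJ JJ)
    then show ?thesis
      using M' by (metis matrix_mul_assoc matrix_mul_rid)
  qed
  define X where "X = M - ?J"
  have "A ** M = mat 1 - ?J"
    using M' JM by (simp add: matrix_add_rdistrib algebra_simps)
  then have AX: "A ** X = mat 1 - ?J"
    by (simp add: X_def matrix_diff_ldistrib AJ)
  have "M ** A = mat 1 - ?J"
    using M MJ by (simp add: matrix_add_ldistrib algebra_simps)
  then have XA: "X ** A = mat 1 - ?J"
    by (simp add: X_def matrix_diff_rdistrib AJ)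
  have "is_pinv A X"
    unfolding is_pinv_def AX XA
    by (simp add: matrix_diff_rdistrib AJ transpose_diff)
      (simp add: X_def matrix_diff_ldistrib JM JJ)
  then have "pinv A = X"
    by (rule pinv_eqI)
  then show "pinv A = M - ?J" "A ** pinv A = mat 1 - ?J"
    using AX by (simp_all add: X_def)
qed

section \<open>Bounds on the log-determinant\<close>

text \<open>A Weierstrass product inequality: expanding the product one factor at a time leaves only
  nonnegative cross terms.\<close>

lemma sum_minus_one_le_prod:
  fixes m :: "'a \<Rightarrow> real"
  assumes "finite S" "\<And>i. i \<in> S \<Longrightarrow> m i \<ge> 1"
  shows "1 + (\<Sum>i\<in>S. m i - 1) \<le> prod m S"
  using assms
proof (induction S rule: finite_induct)
  case (insert x S)
  have "0 \<le> (m x - 1) * (\<Sum>i\<in>S. m i - 1)"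
    using insert.prems by (intro mult_nonneg_nonneg sum_nonneg) auto
  then have "1 + (\<Sum>i\<in>insert x S. m i - 1) \<le> m x * (1 + (\<Sum>i\<in>S. m i - 1))"
    using insert.hyps by (simp add: algebra_simps)
  also have "\<dots> \<le> m x * prod m S"
    using insert by (intro mult_left_mono) (force intro: order_trans)+
  finally show ?case using insert.hyps by simp
qed simp

text \<open>AM-GM in logarithmic form: apply ln x \<le> x - 1 to each \<open>m i / a\<close>, with
  \<open>a\<close> the arithmetic mean; the right-hand sides then sum to 0.\<close>

lemma sum_ln_le:
  fixes m :: "'a \<Rightarrow> real"
  assumes "finite S" "S \<noteq> {}" "\<And>i. i \<in> S \<Longrightarrow> m i > 0"
  shows "(\<Sum>i\<in>S. ln (m i)) \<le> card S * ln (sum m S / card S)"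
proof -
  define a where "a = sum m S / card S"
  have "card S > 0" using assms by auto
  then have a: "a > 0" using assms by (simp add: a_def sum_pos)
  have "(\<Sum>i\<in>S. ln (m i)) - card S * ln a = (\<Sum>i\<in>S. ln (m i / a))"
    using assms(3) a by (simp add: ln_div less_imp_neq[symmetric] sum_subtractf cong: sum.cong)
  also have "\<dots> \<le> (\<Sum>i\<in>S. m i / a - 1)"
    using assms(3) a by (intro sum_mono ln_le_minus_one) auto
  also have "\<dots> = sum m S / a - card S"
    by (simp add: sum_subtractf sum_divide_distrib)
  also have "\<dots> = 0"
    using \<open>card S > 0\<close> a by (auto simp: a_def)
  finally show ?thesis by (simp add: a_def)
qed

text \<open>For Laplacians, \<open>s\<close> is the stretch, by
  \<open>stretch_eq_trace\<close>.\<close>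

theorem ld_bounds:
  fixes A B :: "real^'n^'n"
  assumes A: "psd_const_kernel A" and B: "psd_const_kernel B" and le: "A \<preceq>\<^sub>L B"
    and n: "CARD('n) \<ge> 2"
  defines "s \<equiv> trace (B ** pinv A)"
  shows "ld A + ln (s - real CARD('n) + 2) \<le> ld B"
    and "ld B \<le> ld A + (real CARD('n) - 1) * ln (s / (real CARD('n) - 1))"
proof -
  let ?J = "mean_proj :: real^'n^'n"
  obtain Q a where Q: "orthogonal_matrix Q" "(A + ?J) ** Q = Q ** diag a" "\<And>i. a i > 0"
    and ldA: "ld A = ln (det (A + ?J))" "det (A + ?J) > 0"
    using psd_const_kernel_shift[OF A] by blast
  have ldB: "ld B = ln (det (B + ?J))" "det (B + ?J) > 0"
    using psd_const_kernel_shift[OF B] by metis+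
  have "transpose (B + ?J) = B + ?J"
    using B by (simp add: psd_const_kernel_def pos_semidef_def transpose_add)
  then obtain P :: "real^'n^'n" and m where PA: "transpose P ** (A + ?J) ** P = mat 1"
    and PB: "transpose P ** (B + ?J) ** P = diag m"
    using simultaneous_diagonalization[OF Q] by blast
  have detA: "det P * det (A + ?J) * det P = 1"
    using arg_cong[OF PA, of det] by (simp add: det_mul)
  have detB: "prod m UNIV = det P * det (B + ?J) * det P"
    using arg_cong[OF PB, of det] by (simp add: det_mul det_diag)
  have "det (A + ?J) * prod m UNIV = det P * det (A + ?J) * det P * det (B + ?J)"
    unfolding detB by (simp only: mult_ac)
  then have detBA: "det (B + ?J) = det (A + ?J) * prod m UNIV"
    by (simp add: detA)
  have m_ge: "m i \<ge> 1" for i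
  proof -
    \<comment> \<open>Diagonal entries of a congruence by \<open>P\<close> are quadratic forms at
      the columns of \<open>P\<close>. The shift by \<open>mean_proj\<close> cancels in the
      difference, so the Loewner order applies.\<close>
    let ?p = "P *v axis i 1"
    have form: "?p \<bullet> (M *v ?p) = (transpose P ** M ** P) $ i $ i" for M
    proof -
      have "?p \<bullet> (M *v ?p) = axis i 1 \<bullet> (transpose P *v (M *v ?p))"
        by (metis dot_lmul_matrix vector_transpose_matrix transpose_transpose)
      also have "\<dots> = axis i 1 \<bullet> ((transpose P ** M ** P) *v axis i 1)"
        by (simp add: matrix_vector_mul_assoc matrix_mul_assoc)
      finally show ?thesis
        by (simp only: matrix_vector_mult_basis inner_axis') (simp add: column_def)
    qed
    have "0 \<le> ?p \<bullet> ((B - A) *v ?p)"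
      using le by (auto simp: loewner_le_def pos_semidef_def)
    also have "\<dots> = ?p \<bullet> ((B + ?J) *v ?p) - ?p \<bullet> ((A + ?J) *v ?p)"
      by (simp add: algebra_simps inner_diff_right)
    also have "\<dots> = m i - 1"
      unfolding form PA PB by (simp add: diag_def mat_def)
    finally show ?thesis by simp
  qed
  \<comment> \<open>Thus \<open>P ** transpose P\<close> is the inverse of the shifted
    \<open>A\<close>. By cyclicity of the trace, \<open>s\<close> is the trace of
    \<open>diag m\<close> minus the trace 1 of the projection.\<close>
  have M: "P ** transpose P ** (A + ?J) = mat 1"
    using PA by (metis matrix_left_right_inverse matrix_mul_assoc)
  note pinv_A = pinv_psd_const_kernel[OF A M]
  have "s = trace (B ** (P ** transpose P - ?J))"
    unfolding s_def pinv_A(1) ..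
  also have "\<dots> = trace ((B + ?J) ** (P ** transpose P)) - trace (?J ** (P ** transpose P))"
    by (simp add: matrix_diff_ldistrib matrix_add_rdistrib mult_mean_proj[OF B] trace_add)
  also have "trace ((B + ?J) ** (P ** transpose P)) = trace (transpose P ** (B + ?J) ** P)"
    by (metis matrix_mul_assoc trace_mul_sym)
  finally have s: "s = sum m UNIV - 1"
    by (simp add: PB pinv_A(4) trace_diag trace_mean_proj)
  \<comment> \<open>\<open>w\<close> holds the coordinates of \<open>vec 1\<close> in the columns of
    \<open>P\<close>. Since \<open>B + ?J\<close> fixes \<open>vec 1\<close>, \<open>diag m\<close>
    fixes \<open>w\<close>, and any nonzero coordinate of \<open>w\<close> yields an entry equal to
    1.\<close>
  define w where "w = transpose P *v vec 1"
  have "P *v w = P ** transpose P *v (?J *v vec 1)"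
    by (simp only: w_def mean_proj_vec) (simp only: matrix_vector_mul_assoc)
  also have "\<dots> = vec 1"
    by (metis matrix_vector_mul_assoc pinv_A(3) mean_proj_vec)
  finally have Pw: "P *v w = vec 1" .
  \<comment> \<open>\<open>undefined\<close> is merely an arbitrary index.\<close>
  then have "(P *v w) $ undefined = 1"
    by simp
  then have "w \<noteq> 0"
    by auto
  then obtain k where k: "w $ k \<noteq> 0"
    by (auto simp: vec_eq_iff)
  have "B *v vec 1 = 0"
    using B unfolding psd_const_kernel_def by blast
  then have "(B + ?J) *v vec 1 = vec 1"
    by (simp only: matrix_vector_mult_add_rdistrib mean_proj_vec add_0)
  then have "diag m *v w = w"
    by (metis PB Pw matrix_vector_mul_assoc w_def)
  then have "m k * w $ k = w $ k"
    by (metis diag_mult_vec_nth)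
  then have "m k = 1"
    using k by simp
  define S where "S = UNIV - {k}"
  have UNIV_S: "UNIV = insert k S" "k \<notin> S" and S: "finite S" "card S = CARD('n) - 1"
    by (auto simp: S_def card_Diff_singleton)
  have s_S: "s = sum m S" and prod_S: "prod m UNIV = prod m S"
    using S \<open>m k = 1\<close> by (simp_all add: s UNIV_S)
  have m_pos: "m i > 0" for i
    using m_ge[of i] by linarith
  then have pos: "prod m S > 0"
    by (simp add: prod_pos)
  have ld_eq: "ld B = ld A + ln (prod m S)"
    using ldA ldB detBA[unfolded prod_S] pos ln_mult_pos[of "det (A + ?J)" "prod m S"] by simp
  have "s - real CARD('n) + 2 = 1 + (\<Sum>i\<in>S. m i - 1)"
    using n S by (simp add: s_S sum_subtractf)
  also have "\<dots> \<le> prod m S"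
    using S m_ge by (intro sum_minus_one_le_prod)
  finally have "s - real CARD('n) + 2 \<le> prod m S" .
  \<comment> \<open>The sum over the n - 1 indices in \<open>S\<close> is at least n - 1, so the
    argument is at least 1 and \<open>ln\<close> is monotone there.\<close>
  moreover have "s - real CARD('n) + 2 > 0"
    using n S sum_mono[of S "\<lambda>_. 1" m] m_ge by (simp add: s_S)
  ultimately show "ld A + ln (s - real CARD('n) + 2) \<le> ld B"
    by (simp add: ld_eq)
  have "ln (prod m S) = (\<Sum>i\<in>S. ln (m i))"
    using S m_pos by (simp add: ln_prod less_imp_neq[symmetric])
  also have "\<dots> \<le> card S * ln (sum m S / card S)"
    using S n m_pos by (intro sum_ln_le) auto
  finally show "ld B \<le> ld A + (real CARD('n) - 1) * ln (s / (real CARD('n) - 1))"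
    using n S by (simp add: ld_eq s_S of_nat_diff)
qed

section \<open>Laplacians\<close>

lemma laplacian_nth:
  "laplacian G $ i $ j =
    (\<Sum>(u, v)\<in>edges G. weight G (u, v) * (edge_vec u v $ i * edge_vec u v $ j))"
  by (simp add: laplacian_def case_prod_unfold sum_component matrix_matrix_mult_def
      columnvector_def rowvector_def)

text \<open>Linearity over the edges together with tr(e e^T X) = e^T X e; this turns the stretch
  into a trace.\<close>

lemma trace_laplacian_mult:
  "trace (laplacian G ** X) =
    (\<Sum>(u, v)\<in>edges G. weight G (u, v) * (edge_vec u v \<bullet> (X *v edge_vec u v)))"
proof -
  let ?t = "\<lambda>e i j. weight G e * (edge_vec (fst e) (snd e) $ i * edge_vec (fst e) (snd e) $ j) * X $ j $ i"
  have "trace (laplacian G ** X) = (\<Sum>i\<in>UNIV. \<Sum>j\<in>UNIV. \<Sum>e\<in>edges G. ?t e i j)"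
    by (simp add: trace_def matrix_matrix_mult_def laplacian_nth case_prod_unfold sum_distrib_right)
  also have "\<dots> = (\<Sum>i\<in>UNIV. \<Sum>e\<in>edges G. \<Sum>j\<in>UNIV. ?t e i j)"
    by (subst sum.swap) (rule refl)
  also have "\<dots> = (\<Sum>e\<in>edges G. \<Sum>i\<in>UNIV. \<Sum>j\<in>UNIV. ?t e i j)"
    by (rule sum.swap)
  also have "\<dots> = (\<Sum>e\<in>edges G. \<Sum>j\<in>UNIV. \<Sum>i\<in>UNIV. ?t e i j)"
    by (intro sum.cong refl sum.swap)
  finally show ?thesis
    by (simp add: inner_vec_def matrix_vector_mult_def case_prod_unfold sum_distrib_left mult_ac)
qed

lemma stretch_eq_trace: "stretch H G = trace (laplacian G ** pinv (laplacian H))"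
  by (simp add: stretch_def trace_laplacian_mult)

lemma laplacian_mult_vec_nth:
  "(laplacian G *v x) $ i =
    (\<Sum>(u, v)\<in>edges G. weight G (u, v) * (edge_vec u v $ i * (x $ u - x $ v)))"
proof -
  have edge_sum: "(\<Sum>j\<in>UNIV. edge_vec u v $ j * x $ j) = x $ u - x $ v" for u v
    by (simp add: edge_vec_def axis_def left_diff_distrib sum_subtractf
        if_distrib[of "\<lambda>y. y * _"] cong: if_cong)
  have "(laplacian G *v x) $ i = (\<Sum>j\<in>UNIV. \<Sum>e\<in>edges G. weight G e *
      (edge_vec (fst e) (snd e) $ i * (edge_vec (fst e) (snd e) $ j * x $ j)))"
    by (simp add: matrix_vector_mult_def laplacian_nth case_prod_unfold sum_distrib_right mult.assoc)
  also have "\<dots> = (\<Sum>e\<in>edges G. weight G e *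
      (edge_vec (fst e) (snd e) $ i * (\<Sum>j\<in>UNIV. edge_vec (fst e) (snd e) $ j * x $ j)))"
    by (subst sum.swap) (simp add: sum_distrib_left)
  finally show ?thesis
    by (simp add: edge_sum case_prod_unfold)
qed

lemma laplacian_quadratic_form:
  "x \<bullet> (laplacian G *v x) = (\<Sum>(u, v)\<in>edges G. weight G (u, v) * (x $ u - x $ v)\<^sup>2)"
proof -
  have edge_sum: "(\<Sum>j\<in>UNIV. x $ j * edge_vec u v $ j) = x $ u - x $ v" for u v
    by (simp add: edge_vec_def axis_def right_diff_distrib sum_subtractf
        if_distrib[of "\<lambda>y. _ * y"] cong: if_cong)
  have "x \<bullet> (laplacian G *v x) = (\<Sum>i\<in>UNIV. \<Sum>e\<in>edges G. x $ i * edge_vec (fst e) (snd e) $ i *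
      (weight G e * (x $ fst e - x $ snd e)))"
    by (simp add: inner_vec_def laplacian_mult_vec_nth case_prod_unfold sum_distrib_left mult_ac)
  also have "\<dots> = (\<Sum>e\<in>edges G. (\<Sum>i\<in>UNIV. x $ i * edge_vec (fst e) (snd e) $ i) *
      (weight G e * (x $ fst e - x $ snd e)))"
    by (subst sum.swap) (simp add: sum_distrib_right)
  finally show ?thesis
    by (simp add: edge_sum case_prod_unfold power2_eq_square mult_ac)
qed

text \<open>If \<open>x\<close> is in the kernel, the quadratic form vanishes, hence so does every
  edge term. Positive weights make \<open>x\<close> agree across each edge, and connectedness makes
  it constant.\<close>

lemma psd_const_kernel_laplacian:
  fixes G :: "'n::finite wgraph"
  assumes w: "weighted_graph G" and c: "connected_graph G"
  shows "psd_const_kernel (laplacian G)"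
proof -
  have w_pos: "weight G e > 0" if "e \<in> edges G" for e
    using w that by (simp add: weighted_graph_def)
  have "transpose (laplacian G) = laplacian G"
    by (simp add: vec_eq_iff transpose_def laplacian_nth mult.commute)
  moreover have "0 \<le> x \<bullet> (laplacian G *v x)" for x
    using w_pos by (auto simp: laplacian_quadratic_form less_imp_le intro!: sum_nonneg)
  moreover have "laplacian G *v vec a = 0" for a
    by (simp add: vec_eq_iff laplacian_mult_vec_nth)
  moreover have "\<exists>a. x = vec a" if "laplacian G *v x = 0" for x
  proof -
    have "(\<Sum>(u, v)\<in>edges G. weight G (u, v) * (x $ u - x $ v)\<^sup>2) = 0"
      using that laplacian_quadratic_form[of x G] by simp
    then have "\<forall>(u, v)\<in>edges G. weight G (u, v) * (x $ u - x $ v)\<^sup>2 = 0"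
      by (subst (asm) sum_nonneg_eq_0_iff) (use w_pos in \<open>auto simp: less_imp_le\<close>)
    then have edge: "x $ u = x $ v" if "(u, v) \<in> edges G \<union> (edges G)\<inverse>" for u v
      using that w_pos by fastforce
    have "x $ u = x $ v" if "(u, v) \<in> (edges G \<union> (edges G)\<inverse>)\<^sup>*" for u v
      using that by induction (simp, metis edge)
    then have "x $ u = x $ v" for u v
      using c by (simp add: connected_graph_def)
    then have "x = vec (x $ undefined)"
      by (simp add: vec_eq_iff)
    then show ?thesis ..
  qed
  ultimately show ?thesis
    by (auto simp: psd_const_kernel_def pos_semidef_def)
qed

section \<open>Tightness and the final theorem\<close>

lemma stretch_self:
  fixes G :: "'n::finite wgraph"
  assumes "weighted_graph G" and "connected_graph G"
  shows "stretch G G = real CARD('n) - 1"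
proof -
  note G = psd_const_kernel_laplacian[OF assms]
  have "det (laplacian G + mean_proj) \<noteq> 0"
    using psd_const_kernel_shift[OF G] by (metis less_irrefl)
  then obtain M where "M ** (laplacian G + mean_proj) = mat 1"
    by (metis invertible_det_nz invertible_left_inverse)
  \<comment> \<open>The product of the Laplacian with its pseudo-inverse is
    \<open>mat 1 - mean_proj\<close>, of trace n - 1.\<close>
  then show ?thesis
    using pinv_psd_const_kernel(2)[OF G] by (simp add: stretch_eq_trace trace_sub trace_I trace_mean_proj)
qed

lemma connected_weighted_graph_exists:
  "\<exists>G :: 'n::finite wgraph. weighted_graph G \<and> connected_graph G"
proof -
  obtain f :: "'n \<Rightarrow> nat" where f: "inj f"
    using finite_imp_inj_to_nat_seg[of "UNIV :: 'n set"] by auto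
  \<comment> \<open>The complete graph with unit weights; the injective numbering \<open>f\<close>
    orients each edge once, as \<open>asym\<close> demands.\<close>
  define G :: "'n wgraph" where "G = \<lparr>edges = {(u, v). f u < f v}, weight = \<lambda>_. 1\<rparr>"
  have "weighted_graph G"
    by (auto simp: weighted_graph_def G_def intro!: asymI)
  moreover have "(u, v) \<in> (edges G \<union> (edges G)\<inverse>)\<^sup>*" for u v
  proof (cases "u = v")
    case False
    then have "f u < f v \<or> f v < f u"
      using f by (metis injD linorder_neqE_nat)
    then show ?thesis by (auto simp: G_def)
  qed simp
  ultimately show ?thesis
    by (auto simp: connected_graph_def)
qed

lemma loewner_le_refl: "A \<preceq>\<^sub>L A"
  by (simp add: loewner_le_def pos_semidef_def transpose_def vec_eq_iff)

theorem theorem5: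
  assumes "CARD('n::finite) \<ge> 2"
  shows "(\<forall>G H :: 'n wgraph.
            weighted_graph G \<and> weighted_graph H \<and> connected_graph G \<and> connected_graph H \<and>
            laplacian H \<preceq>\<^sub>L laplacian G \<longrightarrow>
              ld (laplacian H) + ln (stretch H G - real CARD('n) + 2) \<le> ld (laplacian G) \<and>
              ld (laplacian G) \<le> ld (laplacian H) +
                (real CARD('n) - 1) * ln (stretch H G / (real CARD('n) - 1))) \<and>
         (\<exists>G H :: 'n wgraph.
            weighted_graph G \<and> weighted_graph H \<and> connected_graph G \<and> connected_graph H \<and>
            laplacian H \<preceq>\<^sub>L laplacian G \<and>
              ld (laplacian H) + ln (stretch H G - real CARD('n) + 2) = ld (laplacian G) \<and>
              ld (laplacian G) = ld (laplacian H) +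
                (real CARD('n) - 1) * ln (stretch H G / (real CARD('n) - 1)))"
proof (intro conjI allI impI)
  fix G H :: "'n wgraph"
  assume "weighted_graph G \<and> weighted_graph H \<and> connected_graph G \<and> connected_graph H \<and>
    laplacian H \<preceq>\<^sub>L laplacian G"
  then show "ld (laplacian H) + ln (stretch H G - real CARD('n) + 2) \<le> ld (laplacian G)"
    and "ld (laplacian G) \<le> ld (laplacian H) +
      (real CARD('n) - 1) * ln (stretch H G / (real CARD('n) - 1))"
    unfolding stretch_eq_trace using assms
    by (simp_all add: ld_bounds psd_const_kernel_laplacian)
next
  obtain G :: "'n wgraph" where G: "weighted_graph G" "connected_graph G"
    using connected_weighted_graph_exists by blast
  show "\<exists>G H :: 'n wgraph.
      weighted_graph G \<and> weighted_graph H \<and> connected_graph G \<and> connected_graph H \<and>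
      laplacian H \<preceq>\<^sub>L laplacian G \<and>
        ld (laplacian H) + ln (stretch H G - real CARD('n) + 2) = ld (laplacian G) \<and>
        ld (laplacian G) = ld (laplacian H) +
          (real CARD('n) - 1) * ln (stretch H G / (real CARD('n) - 1))"
    \<comment> \<open>With H = G the stretch is n - 1, so both logarithms are ln 1 = 0; n \<ge> 2
      keeps the denominator nonzero.\<close>
    using G assms by (intro exI[of _ G]) (simp add: stretch_self loewner_le_refl)
qed

end
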